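(* Let $\chi\in\psi$ and let $f\in L^{\infty}(\mathbb{R}^2_+)$ be real-valued. Then at every point $(x,y)\in\mathbb{R}^2_+$ at which $f$ is continuous, $$\lim_{w\to\infty}(I_w^{\chi}f)(x,y)=f(x,y).$$ Moreover, if $f\in\mathcal{C}(\mathbb{R}^2_+)$ (real-valued), then $$\lim_{w\to\infty}\|I_w^{\chi}f-f\|_{\infty}=0 .$$
   Context: $\mathbb{R}_+=(0,\infty)$, $\mathbb{R}^2_+=\mathbb{R}_+\times\mathbb{R}_+$, $\|f\|_\infty=\sup_{(x,y)\in\mathbb{R}^2_+}|f(x,y)|$. Function spaces. $C(\mathbb{R}^2_+)$ is the space of continuous bounded functions on $\mathbb{R}^2_+$. $L^\infty(\mathbb{R}^2_+)$ denotes the space of all bounded functions on $\mathbb{R}^2_+$; functions to which the operator below is applied are assumed locally integrable (in particular measurable). $\mathcal{C}(\mathbb{R}^2_+)$ is the space of bounded log-uniformly continuous functions on $\mathbb{R}^2_+$, where $f$ is log-uniformly continuous if for every $\epsilon>0$ there is $\delta>0$ such that $|f(x,y)-f(u,v)|<\epsilon$ whenever $(x,y),(u,v)\in\mathbb{R}^2_+$ satisfy $(\log x-\log u)^2+(\log y-\log v)^2<\delta^2$. Moments. For $\chi\in C(\mathbb{R}^2_+)$ and $p_1,p_2\in\mathbb{N}_0$, the absolute moments are $$M_{(p_1,p_2)}(\chi)=\sup_{(u,v)\in\mathbb{R}^2_+}\sum_{k\in\mathbb{Z}}\sum_{j\in\mathbb{Z}}|\chi(e^{-k}u,e^{-j}v)|\,|k-\log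 u|^{p_1}|j-\log v|^{p_2},$$ and $M_\eta(\chi)=\max_{p_1+p_2=\eta}M_{(p_1,p_2)}(\chi)$ for $\eta\in\mathbb{N}_0$. Kernel class. $\psi$ is the class of real-valued $\chi\in C(\mathbb{R}^2_+)$ such that: (K1) $\sum_{k\in\mathbb{Z}}\sum_{j\in\mathbb{Z}}\chi(e^{-k}u,e^{-j}v)=1$ for every $(u,v)\in\mathbb{R}^2_+$; (K2) $M_2(\chi)<+\infty$ and, for all $p_1,p_2\in\mathbb{N}_0$ with $p_1+p_2=2$, $$\lim_{\gamma\to+\infty}\ \sum\sum_{(k,j)\notin B_\gamma(\log u,\log v)}|\chi(e^{-k}u,e^{-j}v)|\,|k-\log u|^{p_1}|j-\log v|^{p_2}=0$$ uniformly in $(u,v)\in\mathbb{R}^2_+$, where $(k,j)$ ranges over $\mathbb{Z}^2$ and $B_\gamma(a,b)$ is the open Euclidean disc of radius $\gamma$ centred at $(a,b)\in\mathbb{R}^2$. Operator. For $\chi\in\psi$ and $w>0$, the bivariate Kantorovich exponential sampling series of a locally integrable $f:\mathbb{R}^2_+\to\mathbb{R}$ is $$(I_w^{\chi}f)(x,y)=\sum_{k\in\mathbb{Z}}\sum_{j\in\mathbb{Z}}\chi(e^{-k}x^w,e^{-j}y^w)\,w^2\int_{k/w}^{(k+1)/w}\left(\int_{j/w}^{(j+1)/w}f(e^u,e^v)\,dv\right)du,\qquad (x,y)\in\mathbb{R}^2_+,$$ whenever this series converges for every $(x,y)\in\mathbb{R}^2_+$. *)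

theory Defs
  imports "HOL-Analysis.Analysis"
begin

text \<open>
  Functions on the open quadrant are total functions on \<^typ>\<open>real \<times> real\<close>; nothing below depends
  on their values outside the quadrant.
\<close>

definition quadrant :: "(real \<times> real) set"
  where "quadrant = {0<..} \<times> {0<..}"

text \<open>Extended-valued, so that the norm of an unbounded function is \<open>\<infinity>\<close>.\<close>

definition sup_norm :: "(real \<times> real \<Rightarrow> real) \<Rightarrow> ennreal"
  where "sup_norm f = (SUP p\<in>quadrant. ennreal \<bar>f p\<bar>)"

definition cont_bdd :: "(real \<times> real \<Rightarrow> real) set"
  where "cont_bdd = {f. continuous_on quadrant f \<and> bounded (f ` quadrant)}"

definition L_infty :: "(real \<times> real \<Rightarrow> real) set"
  where "L_infty = {f. bounded (f ` quadrant)}"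

text \<open>Measurability and integrability are with respect to (complete) Lebesgue measure on the plane.\<close>

definition locally_integrable :: "(real \<times> real \<Rightarrow> real) \<Rightarrow> bool"
  where "locally_integrable f \<longleftrightarrow>
    (\<forall>K. compact K \<and> K \<subseteq> quadrant \<longrightarrow> set_integrable lebesgue K f)"

definition log_unif_continuous :: "(real \<times> real \<Rightarrow> real) \<Rightarrow> bool"
  where "log_unif_continuous f \<longleftrightarrow>
    (\<forall>\<epsilon>>0. \<exists>\<delta>>0. \<forall>x y u v. (x, y) \<in> quadrant \<and> (u, v) \<in> quadrant \<and>
       (ln x - ln u)\<^sup>2 + (ln y - ln v)\<^sup>2 < \<delta>\<^sup>2 \<longrightarrow> \<bar>f (x, y) - f (u, v)\<bar> < \<epsilon>)"

definition log_unif_cont_bdd :: "(real \<times> real \<Rightarrow> real) set"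
  where "log_unif_cont_bdd = {f. log_unif_continuous f \<and> bounded (f ` quadrant)}"

text \<open>
  An iterated series over \<open>\<int>\<close>, first over the second index: all inner series and the outer series
  converge, and the value is \<open>s\<close>.
\<close>

definition has_double_sum :: "(int \<Rightarrow> int \<Rightarrow> real) \<Rightarrow> real \<Rightarrow> bool"
  where "has_double_sum a s \<longleftrightarrow>
    (\<forall>k. a k summable_on UNIV) \<and> ((\<lambda>k. \<Sum>\<^sub>\<infinity>j. a k j) has_sum s) UNIV"

definition log_shift :: "(real \<times> real \<Rightarrow> real) \<Rightarrow> int \<Rightarrow> int \<Rightarrow> real \<Rightarrow> real \<Rightarrow> real"
  where "log_shift chi k j u v = chi (exp (- of_int k) * u, exp (- of_int j) * v)"

definition moment_term ::
    "(real \<times> real \<Rightarrow> real) \<Rightarrow> nat \<Rightarrow> nat \<Rightarrow> real \<Rightarrow> real \<Rightarrow> int \<Rightarrow> int \<Rightarrow> real"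
  where "moment_term chi p1 p2 u v k j =
    \<bar>log_shift chi k j u v\<bar> * \<bar>of_int k - ln u\<bar> ^ p1 * \<bar>of_int j - ln v\<bar> ^ p2"

definition moment :: "nat \<Rightarrow> nat \<Rightarrow> (real \<times> real \<Rightarrow> real) \<Rightarrow> ennreal"
  where "moment p1 p2 chi =
    (SUP (u, v)\<in>quadrant. \<Sum>\<^sub>\<infinity>k. \<Sum>\<^sub>\<infinity>j. ennreal (moment_term chi p1 p2 u v k j))"

definition moment_max :: "nat \<Rightarrow> (real \<times> real \<Rightarrow> real) \<Rightarrow> ennreal"
  where "moment_max \<eta> chi = Max {moment p1 p2 chi | p1 p2. p1 + p2 = \<eta>}"

text \<open>
  The tail sums in the last condition are real-valued unordered sums over index pairs; they converge
  because the moments of order 2 are finite. Balls in \<^typ>\<open>real \<times> real\<close> are Euclidean discs.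
\<close>

definition kernel_class :: "(real \<times> real \<Rightarrow> real) set"
  where "kernel_class = {chi \<in> cont_bdd.
    (\<forall>(u, v)\<in>quadrant. has_double_sum (\<lambda>k j. log_shift chi k j u v) 1) \<and>
    moment_max 2 chi < \<infinity> \<and>
    (\<forall>p1 p2. p1 + p2 = 2 \<longrightarrow>
      uniform_limit quadrant
        (\<lambda>\<gamma> (u, v). \<Sum>\<^sub>\<infinity>(k, j)\<in>{(k, j). (of_int k, of_int j) \<notin> ball (ln u, ln v) \<gamma>}.
           moment_term chi p1 p2 u v k j)
        (\<lambda>_. 0) at_top)}"

text \<open>
  For a Lebesgue measurable \<open>f\<close> the inner integrand may fail to be measurable for a null set of \<open>u\<close>;
  there the library's inner integral is 0, which does not affect the outer integral.
\<close>

definition kantorovich_term ::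
    "(real \<times> real \<Rightarrow> real) \<Rightarrow> real \<Rightarrow> (real \<times> real \<Rightarrow> real) \<Rightarrow> real \<times> real \<Rightarrow> int \<Rightarrow> int \<Rightarrow> real"
  where "kantorovich_term chi w f = (\<lambda>(x, y) k j.
    log_shift chi k j (x powr w) (y powr w) *
    (w\<^sup>2 * (LINT u:{of_int k / w..(of_int k + 1) / w}|lebesgue.
             (LINT v:{of_int j / w..(of_int j + 1) / w}|lebesgue. f (exp u, exp v)))))"

definition kantorovich_defined ::
    "(real \<times> real \<Rightarrow> real) \<Rightarrow> real \<Rightarrow> (real \<times> real \<Rightarrow> real) \<Rightarrow> bool"
  where "kantorovich_defined chi w f \<longleftrightarrow>
    (\<forall>p\<in>quadrant. \<exists>s. has_double_sum (kantorovich_term chi w f p) s)"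

text \<open>Meaningful only under \<^const>\<open>kantorovich_defined\<close>.\<close>

definition kantorovich ::
    "(real \<times> real \<Rightarrow> real) \<Rightarrow> real \<Rightarrow> (real \<times> real \<Rightarrow> real) \<Rightarrow> real \<times> real \<Rightarrow> real"
  where "kantorovich chi w f p = (\<Sum>\<^sub>\<infinity>k. \<Sum>\<^sub>\<infinity>j. kantorovich_term chi w f p k j)"

end

theory Submission
  imports Defs
begin

text \<open>
  Put \<open>(a, b) = (w * ln x, w * ln y)\<close>. At the point \<open>(x, y)\<close> the series is a sum of kernel values,
  whose total is \<open>1\<close>, times means of \<open>f\<close> over cells of side \<open>1 / w\<close> in logarithmic coordinates,
  the cell with index \<open>(k, j)\<close> having its lower left corner at \<open>(k / w, j / w)\<close>. Hence the error at
  \<open>(x, y)\<close> is the sum of the kernel values times the differences between the cell means and \<open>f (x, y)\<close>.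

  Let \<open>q = (k - a)\<^sup>2 + (j - b)\<^sup>2\<close>. If \<open>f\<close> varies by at most \<open>e\<close> on the logarithmic square of radius
  \<open>d\<close> about \<open>(x, y)\<close> and \<open>\<bar>f\<bar> \<le> C\<close>, then, once \<open>1 / w \<le> d / 2\<close>, a cell mean differs from \<open>f (x, y)\<close> by at most \<open>e\<close> when
  \<open>(k, j)\<close> is within \<open>w * d / 2\<close> of \<open>(a, b)\<close> in both coordinates, and by at most \<open>2 * C\<close>
  otherwise. In the latter case \<open>q\<close> is at least of order \<open>w\<^sup>2\<close>, so for all large \<open>w\<close> the difference
  is at most \<open>e * (1 + q)\<close> for every index. Summing, the error is at most
  \<open>e * M\<close>, where \<open>M\<close> bounds the sums of \<open>\<bar>chi\<bar> * (1 + q)\<close>. This quadratic bound takes the place of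
  splitting the series into a central part and a tail (\<open>kantorovich_close_of_oscillation\<close>).

  The bound \<open>M\<close> exists because the second moments are finite and \<open>chi\<close> is bounded: all but at most four
  lattice points satisfy \<open>q \<ge> 1\<close> (\<open>kernel_weight_bounded\<close>). The same bound gives absolute
  convergence of the series, and with it the freedom to rearrange the iterated sums.

  The measure-theoretic content is that an iterated Lebesgue integral of a merely Lebesgue measurable
  \<open>f\<close> over a cell behaves like a mean (\<open>cell_mean_close\<close>). Finally, both continuity at a point and
  log-uniform continuity provide, for each \<open>e\<close>, a radius \<open>d\<close>, in the second case the same one for
  all points.
\<close>

section \<open>Means of a function over logarithmic cells\<close>

text \<open>
  On the interval \<open>h\<close> is only Lebesgue measurable, being almost everywhere equal there to the Borel
  function \<open>g\<close>. Replacing it by \<open>g\<close> does not change the integral, and after that the bound is monotonicity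
  of the integral. Both hypotheses on \<open>h\<close> hold almost everywhere only, so that the lemma can be
  applied to the inner and then to the outer of two iterated integrals.
\<close>

lemma set_integral_close:
  fixes g h :: "real \<Rightarrow> real"
  assumes g: "g \<in> borel_measurable borel"
    and eq: "AE x in lborel. x \<in> {a..b} \<longrightarrow> h x = g x"
    and close: "AE x in lborel. x \<in> {a..b} \<longrightarrow> \<bar>h x - m\<bar> \<le> e"
    and "a \<le> b"
  shows "(LINT x:{a..b}|lebesgue. h x) = (LINT x:{a..b}|lborel. g x)"
    and "\<bar>(LINT x:{a..b}|lebesgue. h x) - m * (b - a)\<bar> \<le> e * (b - a)"
proof -
  define G where "G = (\<lambda>x. indicator {a..b} x *\<^sub>R g x)"
  have Gm: "G \<in> borel_measurable lborel"
    unfolding G_def using g by measurable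
  have AEeq: "AE x in lebesgue. G x = indicator {a..b} x *\<^sub>R h x"
    by (rule AE_completion) (use eq in \<open>auto simp: G_def indicator_def elim!: eventually_mono\<close>)
  have Gl: "G \<in> borel_measurable lebesgue"
    using Gm by (rule measurable_completion)
  have "(LINT x:{a..b}|lebesgue. h x) = integral\<^sup>L lebesgue G"
    unfolding set_lebesgue_integral_def
    by (rule integral_cong_AE[symmetric, OF Gl borel_measurable_AE[OF Gl AEeq] AEeq])
  also have "\<dots> = integral\<^sup>L lborel G"
    using Gm by (rule integral_completion)
  finally have int: "(LINT x:{a..b}|lebesgue. h x) = integral\<^sup>L lborel G" .
  then show "(LINT x:{a..b}|lebesgue. h x) = (LINT x:{a..b}|lborel. g x)"
    by (simp add: G_def set_lebesgue_integral_def)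
  have const: "integrable lborel (\<lambda>x. c * indicat_real {a..b} x)" 
    "(LINT x|lborel. c * indicat_real {a..b} x) = c * (b - a)" for c
    using \<open>a \<le> b\<close> by auto
  have bounds: "AE x in lborel. (m - e) * indicat_real {a..b} x \<le> G x"
    "AE x in lborel. G x \<le> (m + e) * indicat_real {a..b} x"
    using eq close by (eventually_elim, auto simp: G_def indicator_def)+
  have "integrable lborel G"
    by (rule Bochner_Integration.integrable_bound[OF const(1)[of "\<bar>m\<bar> + \<bar>e\<bar>"] Gm])
      (use bounds in \<open>eventually_elim, auto simp: indicator_def G_def\<close>)
  then have "(m - e) * (b - a) \<le> integral\<^sup>L lborel G" "integral\<^sup>L lborel G \<le> (m + e) * (b - a)"
    using integral_mono_AE[OF const(1) _ bounds(1)] integral_mono_AE[OF _ const(1) bounds(2)]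
    by (auto simp: const(2)[simplified] \<open>a \<le> b\<close>)
  then show "\<bar>(LINT x:{a..b}|lebesgue. h x) - m * (b - a)\<bar> \<le> e * (b - a)"
    by (simp add: int abs_le_iff algebra_simps)
qed

text \<open>
  The exceptional set of \<open>P\<close>, expressed in logarithmic coordinates, lies in the image of a null set under
  the map \<open>(x, y) \<mapsto> (ln x, ln y)\<close>, which is differentiable on the quadrant and hence maps null sets
  to null sets. Fubini's theorem turns a null set of the plane into almost everywhere null slices.
\<close>

lemma AE_lborel_exp_substitution:
  assumes "AE z in lborel. P (z :: real \<times> real)"
  shows "AE u in lborel. AE v in lborel. P (exp u, exp v)"
proof -
  obtain N where N: "N \<in> null_sets lborel" "{z. \<not> P z} \<subseteq> N"
    using assms unfolding eventually_ae_filter by auto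
  define L where "L = (\<lambda>z :: real \<times> real. (ln (fst z), ln (snd z)))"
  have "negligible N"
    using N(1) by (simp add: negligible_iff_null_sets null_sets_completionI)
  then have "negligible (N \<inter> quadrant)"
    by (rule negligible_subset) simp
  moreover have "L differentiable_on (N \<inter> quadrant)"
    unfolding differentiable_on_def L_def
  proof
    fix z assume "z \<in> N \<inter> quadrant"
    then have "((\<lambda>z. (ln (fst z), ln (snd z))) has_derivative
        (\<lambda>h. (fst h / fst z, snd h / snd z))) (at z within N \<inter> quadrant)"
      by (auto intro!: derivative_eq_intros simp: quadrant_def field_simps)
    then show "(\<lambda>z. (ln (fst z), ln (snd z))) differentiable at z within N \<inter> quadrant"
      by (rule differentiableI)
  qed
  ultimately have "negligible (L ` (N \<inter> quadrant))"
    by (intro negligible_differentiable_image_negligible) auto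
  then have "L ` (N \<inter> quadrant) \<in> null_sets lebesgue"
    by (simp add: negligible_iff_null_sets)
  then have "AE z in lebesgue. z \<notin> L ` (N \<inter> quadrant)"
    by (rule AE_not_in)
  then have "AE z in lborel. z \<notin> L ` (N \<inter> quadrant)"
    by (simp add: AE_completion_iff)
  then have "AE z in lborel. P (exp (fst z), exp (snd z))"
  proof (rule eventually_mono)
    fix z :: "real \<times> real"
    assume "z \<notin> L ` (N \<inter> quadrant)"
    moreover have "z = L (exp (fst z), exp (snd z))"
      by (simp add: L_def)
    ultimately have "(exp (fst z), exp (snd z)) \<notin> N"
      by (auto simp: quadrant_def)
    with N(2) show "P (exp (fst z), exp (snd z))" by auto
  qed
  then have "AE z in lborel \<Otimes>\<^sub>M lborel. P (exp (fst z), exp (snd z))"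
    unfolding lborel_prod .
  from lborel_pair.AE_pair[OF this] show ?thesis by simp
qed

definition cell_mean :: "real \<Rightarrow> (real \<times> real \<Rightarrow> real) \<Rightarrow> int \<Rightarrow> int \<Rightarrow> real"
  where "cell_mean w f k j =
    w\<^sup>2 * (LINT u:{of_int k / w..(of_int k + 1) / w}|lebesgue.
             (LINT v:{of_int j / w..(of_int j + 1) / w}|lebesgue. f (exp u, exp v)))"

text \<open>
  In logarithmic coordinates \<open>f\<close> agrees on the cell with a Borel function \<open>g\<close>, up to a null set. For
  almost every \<open>u\<close> the inner integral is therefore that of a slice of \<open>g\<close>, which makes it measurable
  in \<open>u\<close> and within \<open>e / w\<close> of \<open>m / w\<close>; a second integration over an interval of length \<open>1 / w\<close>
  gives the claim. Taking \<open>m = 0\<close> yields the bound of a mean by the supremum of \<open>\<bar>f\<bar>\<close>.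
\<close>

lemma cell_mean_close:
  assumes f: "locally_integrable f" and w: "w > 0"
    and close: "\<And>u v. u \<in> {of_int k / w..(of_int k + 1) / w} \<Longrightarrow>
      v \<in> {of_int j / w..(of_int j + 1) / w} \<Longrightarrow> \<bar>f (exp u, exp v) - m\<bar> \<le> e"
  shows "\<bar>cell_mean w f k j - m\<bar> \<le> e"
proof -
  define a b c d where "a = of_int k / w" "b = (of_int k + 1) / w"
    "c = of_int j / w" "d = (of_int j + 1) / w"
  have ba: "b - a = 1 / w" and dc: "d - c = 1 / w"
    using w by (auto simp: a_b_c_d_def field_simps)
  have "0 < 1 / w" using w by simp
  with ba dc have ab: "a \<le> b" and cd: "c \<le> d" by linarith+
  (* the cell, mapped back to the quadrant *)
  define K where "K = {exp a..exp b} \<times> {exp c..exp d}"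
  have "compact K" "K \<subseteq> quadrant"
    by (auto simp: K_def quadrant_def intro!: compact_Times less_le_trans[OF exp_gt_zero])
  with f have "integrable lebesgue (\<lambda>z. indicator K z *\<^sub>R f z)"
    by (auto simp: locally_integrable_def set_integrable_def)
  then obtain g where g: "g \<in> borel_measurable lborel"
    and "AE z in lborel. indicator K z *\<^sub>R f z = g z"
    using completion_ex_borel_measurable_real[OF borel_measurable_integrable] by blast
  note AE = AE_lborel_exp_substitution[OF this(2)]
  have gm [measurable]: "(\<lambda>(u, v). g (exp u, exp v)) \<in> borel_measurable (borel \<Otimes>\<^sub>M lborel)"
    using g by (simp add: borel_prod[symmetric]) 
  define h where "h = (\<lambda>u. LINT v:{c..d}|lebesgue. f (exp u, exp v))"
  define J where "J = (\<lambda>u. LINT v:{c..d}|lborel. g (exp u, exp v))"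
  have J: "J \<in> borel_measurable borel"
    unfolding J_def set_lebesgue_integral_def by measurable
  have inner: "AE u in lborel. u \<in> {a..b} \<longrightarrow> h u = J u \<and> \<bar>h u - m * (d - c)\<bar> \<le> e * (d - c)"
    using AE
  proof eventually_elim
    fix u assume *: "AE v in lborel. indicator K (exp u, exp v) *\<^sub>R f (exp u, exp v) = g (exp u, exp v)"
    show "u \<in> {a..b} \<longrightarrow> h u = J u \<and> \<bar>h u - m * (d - c)\<bar> \<le> e * (d - c)"
    proof
      assume u: "u \<in> {a..b}"
      have eq: "AE v in lborel. v \<in> {c..d} \<longrightarrow> f (exp u, exp v) = g (exp u, exp v)"
        using * by eventually_elim (use u in \<open>auto simp: K_def\<close>)
      have cl: "AE v in lborel. v \<in> {c..d} \<longrightarrow> \<bar>f (exp u, exp v) - m\<bar> \<le> e"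
        using u close by (auto simp: a_b_c_d_def)
      have gu: "(\<lambda>v. g (exp u, exp v)) \<in> borel_measurable borel"
        using measurable_compose[OF measurable_Pair1' gm, of u] by simp
      from set_integral_close[OF gu eq cl cd]
      show "h u = J u \<and> \<bar>h u - m * (d - c)\<bar> \<le> e * (d - c)"
        by (simp add: h_def J_def)
    qed
  qed
  have "\<bar>(LINT u:{a..b}|lebesgue. h u) - m * (d - c) * (b - a)\<bar> \<le> e * (d - c) * (b - a)"
    by (rule set_integral_close(2)[OF J _ _ ab]) (use inner in \<open>auto elim!: eventually_mono\<close>)
  then have "w\<^sup>2 * \<bar>(LINT u:{a..b}|lebesgue. h u) - m * (d - c) * (b - a)\<bar> \<le> w\<^sup>2 * (e * (d - c) * (b - a))"
    by (rule mult_left_mono) simp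
  also have "w\<^sup>2 * (e * (d - c) * (b - a)) = e"
    using w by (simp add: ba dc power2_eq_square)
  also have "w\<^sup>2 * \<bar>(LINT u:{a..b}|lebesgue. h u) - m * (d - c) * (b - a)\<bar>
      = \<bar>w\<^sup>2 * ((LINT u:{a..b}|lebesgue. h u) - m * (d - c) * (b - a))\<bar>"
    by (simp add: abs_mult)
  also have "w\<^sup>2 * ((LINT u:{a..b}|lebesgue. h u) - m * (d - c) * (b - a))
      = w\<^sup>2 * (LINT u:{a..b}|lebesgue. h u) - m"
    using w unfolding ba dc by (simp add: right_diff_distrib power2_eq_square)
  also have "w\<^sup>2 * (LINT u:{a..b}|lebesgue. h u) = cell_mean w f k j"
    by (simp only: cell_mean_def h_def a_b_c_d_def)
  finally show ?thesis .
qed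

lemma log_unif_continuous_imp_continuous_on:
  assumes "log_unif_continuous f"
  shows "continuous_on quadrant f"
proof -
  have "\<exists>d>0. \<forall>z'\<in>quadrant. dist z' z < d \<longrightarrow> dist (f z') (f z) < e" if z: "z \<in> quadrant" and e: "e > 0" for z e
  proof -
    obtain r where r: "r > 0" "\<And>x y u v. (x, y) \<in> quadrant \<Longrightarrow> (u, v) \<in> quadrant \<Longrightarrow>
       (ln x - ln u)\<^sup>2 + (ln y - ln v)\<^sup>2 < r\<^sup>2 \<Longrightarrow> \<bar>f (x, y) - f (u, v)\<bar> < e"
      using assms e unfolding log_unif_continuous_def by meson
    have "continuous_on quadrant (\<lambda>z :: real \<times> real. (ln (fst z), ln (snd z)))"
      by (intro continuous_intros) (auto simp: quadrant_def)
    with z r(1) obtain d where d: "d > 0" "\<And>z'. z' \<in> quadrant \<Longrightarrow> dist z' z < d \<Longrightarrow>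
        dist (ln (fst z'), ln (snd z')) (ln (fst z), ln (snd z)) < r"
      unfolding continuous_on_iff by meson
    have "dist (f z') (f z) < e" if "z' \<in> quadrant" "dist z' z < d" for z'
    proof -
      let ?X = "(ln (fst z') - ln (fst z))\<^sup>2 + (ln (snd z') - ln (snd z))\<^sup>2"
      have "sqrt ?X < r"
        using d(2)[OF that] by (simp add: dist_Pair_Pair dist_real_def)
      then have "(sqrt ?X)\<^sup>2 < r\<^sup>2"
        by (intro power_strict_mono) auto
      then have "?X < r\<^sup>2" by simp
      then show ?thesis
        using r(2)[of "fst z'" "snd z'" "fst z" "snd z"] that z by (simp add: dist_real_def)
    qed
    with d(1) show ?thesis by blast
  qed
  then show ?thesis unfolding continuous_on_iff by blast
qed

lemma continuous_on_imp_locally_integrable: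
  assumes "continuous_on quadrant f"
  shows "locally_integrable f"
  unfolding locally_integrable_def set_integrable_def
proof safe
  fix K :: "(real \<times> real) set" assume K: "compact K" "K \<subseteq> quadrant"
  have int: "integrable lborel (\<lambda>z. indicator K z *\<^sub>R f z)"
    by (rule borel_integrable_compact[OF K(1) continuous_on_subset[OF assms K(2)]])
  then show "integrable lebesgue (\<lambda>z. indicator K z *\<^sub>R f z)"
    using integrable_completion[OF borel_measurable_integrable[OF int]] by blast
qed

section \<open>Absolute moments of the kernel\<close>

lemma abs_summable_imp_has_double_sum:
  assumes "(\<lambda>(k, j). \<bar>a k j\<bar>) summable_on (UNIV :: (int \<times> int) set)"
  shows "has_double_sum a (\<Sum>\<^sub>\<infinity>(k, j)\<in>UNIV. a k j)"
proof -
  have s: "(\<lambda>(k, j). a k j) summable_on Sigma UNIV (\<lambda>_. UNIV)"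
    using abs_summable_summable[of "\<lambda>(k, j). a k j" UNIV] assms by (simp add: case_prod_unfold)
  have inner: "a k summable_on UNIV" for k
    by (rule summable_on_SigmaD1[OF s UNIV_I])
  have "((\<lambda>k. \<Sum>\<^sub>\<infinity>j. a k j) has_sum (\<Sum>\<^sub>\<infinity>(k, j)\<in>UNIV. a k j)) UNIV"
    by (rule has_sum_SigmaD[where B = "\<lambda>_. UNIV" and f = "\<lambda>(k, j). a k j"])
      (use s inner in auto)
  with inner show ?thesis by (simp add: has_double_sum_def)
qed

text \<open>
  Passing to finite partial sums changes an iterated sum into an unordered sum over pairs:
  a finite set of pairs lies in the product of its projections, and over a finite product the two
  kinds of summation agree.
\<close>

lemma sum_le_of_iterated_ennreal_infsum:
  fixes t :: "'a \<Rightarrow> 'b \<Rightarrow> real"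
  assumes nonneg: "\<And>k j. t k j \<ge> 0"
    and bound: "(\<Sum>\<^sub>\<infinity>k. \<Sum>\<^sub>\<infinity>j. ennreal (t k j)) \<le> ennreal M" and "M \<ge> 0"
    and "finite F"
  shows "(\<Sum>(k, j)\<in>F. t k j) \<le> M"
proof -
  have part: "sum g A \<le> infsum g UNIV" if "finite A" for g :: "'c \<Rightarrow> ennreal" and A
    using infsum_mono_neutral[of g A g UNIV] that by (simp add: nonneg_summable_on_complete)
  have "ennreal (\<Sum>(k, j)\<in>F. t k j) \<le> ennreal (\<Sum>(k, j)\<in>fst ` F \<times> snd ` F. t k j)"
    using nonneg \<open>finite F\<close> by (intro ennreal_leI sum_mono2) (auto intro: rev_image_eqI)
  also have "\<dots> = (\<Sum>k\<in>fst ` F. \<Sum>j\<in>snd ` F. ennreal (t k j))"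
    by (simp add: sum.cartesian_product[symmetric] sum_ennreal[symmetric] nonneg sum_nonneg del: sum_ennreal)
  also have "\<dots> \<le> (\<Sum>k\<in>fst ` F. \<Sum>\<^sub>\<infinity>j. ennreal (t k j))"
    using \<open>finite F\<close> by (intro sum_mono part) simp
  also have "\<dots> \<le> (\<Sum>\<^sub>\<infinity>k. \<Sum>\<^sub>\<infinity>j. ennreal (t k j))"
    using \<open>finite F\<close> by (intro part) simp
  also have "\<dots> \<le> ennreal M" by (rule bound)
  finally show ?thesis using \<open>M \<ge> 0\<close> by (simp add: ennreal_le_iff)
qed

text \<open>
  The general term of the absolute moment of order \<open>0\<close> plus those of the two pure moments of order \<open>2\<close>.
\<close>

definition kernel_weight :: "(real \<times> real \<Rightarrow> real) \<Rightarrow> real \<Rightarrow> real \<Rightarrow> int \<Rightarrow> int \<Rightarrow> real"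
  where "kernel_weight chi u v k j =
    \<bar>log_shift chi k j u v\<bar> * (1 + ((of_int k - ln u)\<^sup>2 + (of_int j - ln v)\<^sup>2))"

lemma kernel_weight_nonneg: "kernel_weight chi u v k j \<ge> 0"
  by (simp add: kernel_weight_def)

text \<open>
  Unless \<open>(k, j)\<close> is one of the four corners of the integer unit square containing \<open>(ln u, ln v)\<close>,
  at least one of \<open>\<bar>k - ln u\<bar>\<close> and \<open>\<bar>j - ln v\<bar>\<close> is at least \<open>1\<close>, so that the factor \<open>1\<close> is dominated by
  the square of the distance.
\<close>

lemma abs_log_shift_le_second_moments:
  assumes B: "\<bar>log_shift chi k j u v\<bar> \<le> B"
  shows "\<bar>log_shift chi k j u v\<bar> \<le>
    \<bar>log_shift chi k j u v\<bar> * ((of_int k - ln u)\<^sup>2 + (of_int j - ln v)\<^sup>2)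
    + (if (k, j) \<in> {\<lfloor>ln u\<rfloor>, \<lfloor>ln u\<rfloor> + 1} \<times> {\<lfloor>ln v\<rfloor>, \<lfloor>ln v\<rfloor> + 1} then B else 0)"
proof (cases "(k, j) \<in> {\<lfloor>ln u\<rfloor>, \<lfloor>ln u\<rfloor> + 1} \<times> {\<lfloor>ln v\<rfloor>, \<lfloor>ln v\<rfloor> + 1}")
  case True
  have "0 \<le> \<bar>log_shift chi k j u v\<bar> * ((of_int k - ln u)\<^sup>2 + (of_int j - ln v)\<^sup>2)" by simp
  with B have "\<bar>log_shift chi k j u v\<bar> \<le>
      \<bar>log_shift chi k j u v\<bar> * ((of_int k - ln u)\<^sup>2 + (of_int j - ln v)\<^sup>2) + B" by linarith
  with True show ?thesis by (simp only: if_True)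
next
  case False
  have "\<bar>of_int n - a\<bar> \<ge> 1" if "n \<notin> {\<lfloor>a\<rfloor>, \<lfloor>a\<rfloor> + 1}" for n and a :: real
  proof -
    from that have "n \<le> \<lfloor>a\<rfloor> - 1 \<or> n \<ge> \<lfloor>a\<rfloor> + 2" by auto
    then have "real_of_int n \<le> of_int \<lfloor>a\<rfloor> - 1 \<or> real_of_int n \<ge> of_int \<lfloor>a\<rfloor> + 2" by linarith
    then show ?thesis by linarith
  qed
  with False have "\<bar>of_int k - ln u\<bar> \<ge> 1 \<or> \<bar>of_int j - ln v\<bar> \<ge> 1"
    by blast
  then have "1\<^sup>2 \<le> (of_int k - ln u)\<^sup>2 \<or> 1\<^sup>2 \<le> (of_int j - ln v)\<^sup>2"
    by (metis abs_le_square_iff abs_one)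
  then have "1 \<le> (of_int k - ln u)\<^sup>2 + (of_int j - ln v)\<^sup>2"
    using zero_le_power2[of "of_int k - ln u"] zero_le_power2[of "of_int j - ln v"]
    unfolding one_power2 by linarith
  then have "\<bar>log_shift chi k j u v\<bar> * 1 \<le>
      \<bar>log_shift chi k j u v\<bar> * ((of_int k - ln u)\<^sup>2 + (of_int j - ln v)\<^sup>2)"
    by (intro mult_left_mono) auto
  with False show ?thesis by (simp only: if_False add_0_right mult_1_right)
qed

text \<open>
  Finite moments of order \<open>2\<close> and boundedness of the kernel bound the moment of order \<open>0\<close>: the four
  corners of the integer unit square containing \<open>(ln u, ln v)\<close> contribute at most \<open>4 * B\<close>, the others at most the two
  pure second moments. All these bounds are uniform in \<open>(u, v)\<close>.
\<close>

lemma kernel_weight_bounded: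
  assumes chi: "chi \<in> kernel_class"
  obtains M where "M \<ge> 0"
    and "\<And>u v. (u, v) \<in> quadrant \<Longrightarrow> (\<lambda>(k, j). kernel_weight chi u v k j) summable_on UNIV"
    and "\<And>u v. (u, v) \<in> quadrant \<Longrightarrow> (\<Sum>\<^sub>\<infinity>(k, j)\<in>UNIV. kernel_weight chi u v k j) \<le> M"
proof -
  from chi have "bounded (chi ` quadrant)" and mm: "moment_max 2 chi < \<infinity>"
    by (auto simp: kernel_class_def cont_bdd_def)
  then obtain B where "\<And>z. z \<in> quadrant \<Longrightarrow> \<bar>chi z\<bar> \<le> B"
    by (auto simp: bounded_iff)
  then have B: "\<bar>log_shift chi k j u v\<bar> \<le> B" if "(u, v) \<in> quadrant" for k j u v
    using that by (auto simp: log_shift_def quadrant_def)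
  have "(1, 1) \<in> quadrant" by (simp add: quadrant_def)
  from B[OF this, of 0 0] have "B \<ge> 0" by linarith
  define m where "m p q = enn2real (moment p q chi)" for p q
  have fin: "finite {moment p1 p2 chi | p1 p2. p1 + p2 = 2}"
    by (rule finite_subset[of _ "(\<lambda>(p, q). moment p q chi) ` ({..2} \<times> {..2})"]) auto
  have mom: "moment p q chi = ennreal (m p q)" if "p + q = 2" for p q
  proof -
    have "moment p q chi \<le> moment_max 2 chi"
      unfolding moment_max_def by (rule Max_ge[OF fin]) (use that in blast)
    with mm show ?thesis by (simp add: m_def less_top)
  qed
  have m_sum: "(\<Sum>(k, j)\<in>F. moment_term chi p q u v k j) \<le> m p q"
    if "(u, v) \<in> quadrant" "p + q = 2" "finite F" for p q u v F
  proof (rule sum_le_of_iterated_ennreal_infsum[OF _ _ _ \<open>finite F\<close>])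
    show "(\<Sum>\<^sub>\<infinity>k. \<Sum>\<^sub>\<infinity>j. ennreal (moment_term chi p q u v k j)) \<le> ennreal (m p q)"
      unfolding mom[OF that(2), symmetric] moment_def using that(1) by (rule SUP_upper2) simp
  qed (auto simp: moment_term_def m_def)
  define M where "M = 2 * (m 2 0 + m 0 2) + 4 * B"
  have "M \<ge> 0" using \<open>B \<ge> 0\<close> by (simp add: M_def m_def)
  have fsum: "(\<Sum>(k, j)\<in>F. kernel_weight chi u v k j) \<le> M"
    if uv: "(u, v) \<in> quadrant" and F: "finite F" for u v F
  proof -
    define T where "T = {\<lfloor>ln u\<rfloor>, \<lfloor>ln u\<rfloor> + 1} \<times> {\<lfloor>ln v\<rfloor>, \<lfloor>ln v\<rfloor> + 1}"
    have T: "finite T" "card T = 4" by (auto simp: T_def card_cartesian_product)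
    have "kernel_weight chi u v k j \<le> 2 * (moment_term chi 2 0 u v k j + moment_term chi 0 2 u v k j)
        + (if (k, j) \<in> T then B else 0)" for k j
      using abs_log_shift_le_second_moments[OF B[OF uv], of k j]
      by (auto simp: kernel_weight_def moment_term_def T_def algebra_simps)
    then have "(\<Sum>(k, j)\<in>F. kernel_weight chi u v k j)
        \<le> (\<Sum>(k, j)\<in>F. 2 * (moment_term chi 2 0 u v k j + moment_term chi 0 2 u v k j)
            + (if (k, j) \<in> T then B else 0))"
      by (intro sum_mono) auto
    also have "\<dots> = 2 * ((\<Sum>(k, j)\<in>F. moment_term chi 2 0 u v k j) + (\<Sum>(k, j)\<in>F. moment_term chi 0 2 u v k j))
        + (\<Sum>z\<in>F. if z \<in> T then B else 0)"
      by (simp add: case_prod_unfold sum.distrib sum_distrib_left)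
    also have "(\<Sum>z\<in>F. if z \<in> T then B else 0) = card (F \<inter> T) * B"
      using F by (simp add: sum.If_cases)
    also have "card (F \<inter> T) * B \<le> 4 * B"
      using card_mono[OF T(1), of "F \<inter> T"] T(2) \<open>B \<ge> 0\<close> by (intro mult_right_mono) auto
    finally show ?thesis
      using m_sum[OF uv _ F, of 2 0] m_sum[OF uv _ F, of 0 2] by (simp add: M_def)
  qed
  have summ: "(\<lambda>(k, j). kernel_weight chi u v k j) summable_on UNIV" if "(u, v) \<in> quadrant" for u v
    by (rule nonneg_bdd_above_summable_on)
      (use fsum[OF that] in \<open>auto simp: kernel_weight_nonneg intro!: bdd_aboveI2[of _ _ M]\<close>)
  show thesis
    by (rule that[OF \<open>M \<ge> 0\<close> summ]) (auto intro!: infsum_le_finite_sums[OF summ] fsum)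
qed

section \<open>Approximation by the sampling series\<close>

text \<open>
  Since the kernel sums to \<open>1\<close>, the difference \<open>s - m\<close> is the sum of \<open>chi * (A - m)\<close>, and each term
  is at most \<open>e\<close> times a term of the weighted kernel sum. The allowance for \<open>A - m\<close> grows with
  the square of the distance, so that one hypothesis covers both near and far indices.
\<close>

lemma kernel_sum_close:
  assumes weight: "(\<lambda>(k, j). kernel_weight chi u v k j) summable_on UNIV"
    and one: "has_double_sum (\<lambda>k j. log_shift chi k j u v) 1"
    and A: "\<And>k j. \<bar>A k j - m\<bar> \<le> e * (1 + ((of_int k - ln u)\<^sup>2 + (of_int j - ln v)\<^sup>2))"
  obtains s where "has_double_sum (\<lambda>k j. log_shift chi k j u v * A k j) s"
    and "\<bar>s - m\<bar> \<le> e * (\<Sum>\<^sub>\<infinity>(k, j)\<in>UNIV. kernel_weight chi u v k j)"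
proof -
  define c where "c = (\<lambda>k j. log_shift chi k j u v)"
  have abs_sum: "(\<lambda>(k, j). \<bar>c k j * a k j\<bar>) summable_on UNIV"
    if a: "\<And>k j. \<bar>a k j\<bar> \<le> d * (1 + ((of_int k - ln u)\<^sup>2 + (of_int j - ln v)\<^sup>2))" for a d
  proof -
    have "\<bar>c k j * a k j\<bar> \<le> d * kernel_weight chi u v k j" for k j
      using mult_left_mono[OF a[of k j], of "\<bar>c k j\<bar>"]
      by (simp add: abs_mult kernel_weight_def c_def mult_ac)
    moreover have "(\<lambda>z. d * (\<lambda>(k, j). kernel_weight chi u v k j) z) summable_on UNIV"
      by (rule summable_on_cmult_right[OF weight])
    ultimately show ?thesis
      by (elim summable_on_comparison_test) auto
  qed
  have close: "(\<lambda>(k, j). \<bar>c k j * (A k j - m)\<bar>) summable_on UNIV"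
    by (rule abs_sum[OF A])
  have "(\<lambda>(k, j). \<bar>c k j * 1\<bar>) summable_on UNIV"
    by (rule abs_sum[of _ 1]) simp
  then have c: "(\<lambda>(k, j). \<bar>c k j\<bar>) summable_on UNIV" by simp
  have "has_double_sum c (\<Sum>\<^sub>\<infinity>(k, j)\<in>UNIV. c k j)"
    by (rule abs_summable_imp_has_double_sum[OF c])
  with one have c1: "(\<Sum>\<^sub>\<infinity>(k, j)\<in>UNIV. c k j) = 1"
    unfolding c_def has_double_sum_def by (blast intro: has_sum_unique)
  have c': "(\<lambda>z. (\<lambda>(k, j). c k j) z) summable_on UNIV"
    using abs_summable_summable[of "\<lambda>(k, j). c k j" UNIV] c by (simp add: case_prod_unfold)
  have cA: "(\<lambda>(k, j). \<bar>c k j * A k j\<bar>) summable_on UNIV"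
  proof (rule abs_sum)
    fix k j
    have "\<bar>m\<bar> * 1 \<le> \<bar>m\<bar> * (1 + ((of_int k - ln u)\<^sup>2 + (of_int j - ln v)\<^sup>2))"
      by (intro mult_left_mono) auto
    with A[of k j] show "\<bar>A k j\<bar> \<le> (e + \<bar>m\<bar>) * (1 + ((of_int k - ln u)\<^sup>2 + (of_int j - ln v)\<^sup>2))"
      by (simp add: distrib_right)
  qed
  define s where "s = (\<Sum>\<^sub>\<infinity>(k, j)\<in>UNIV. c k j * A k j)"
  have cA': "(\<lambda>(k, j). c k j * A k j) summable_on UNIV"
    using abs_summable_summable[of "\<lambda>(k, j). c k j * A k j" UNIV] cA by (simp add: case_prod_unfold)
  have "((\<lambda>(k, j). c k j * A k j) has_sum s) UNIV"
    unfolding s_def by (rule has_sum_infsum[OF cA'])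
  moreover have "((\<lambda>(k, j). c k j) has_sum 1) UNIV"
    using has_sum_infsum[OF c'] c1 by simp
  then have "((\<lambda>z. (- m) * (\<lambda>(k, j). c k j) z) has_sum (- m) * 1) UNIV"
    by (rule has_sum_cmult_right)
  ultimately have "((\<lambda>z. (\<lambda>(k, j). c k j * A k j) z + (- m) * (\<lambda>(k, j). c k j) z) has_sum
      (s + (- m) * 1)) UNIV"
    by (rule has_sum_add)
  then have "((\<lambda>(k, j). c k j * (A k j - m)) has_sum (s - m)) UNIV"
    by (simp add: case_prod_unfold algebra_simps)
  moreover have "((\<lambda>z. e * (\<lambda>(k, j). kernel_weight chi u v k j) z) has_sum
      e * (\<Sum>\<^sub>\<infinity>(k, j)\<in>UNIV. kernel_weight chi u v k j)) UNIV"
    by (rule has_sum_cmult_right[OF has_sum_infsum[OF weight]])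
  ultimately have "norm (s - m) \<le> e * (\<Sum>\<^sub>\<infinity>(k, j)\<in>UNIV. kernel_weight chi u v k j)"
  proof (rule norm_infsum_le)
    fix z :: "int \<times> int"
    obtain k j where z: "z = (k, j)" by (cases z)
    show "norm (case z of (k, j) \<Rightarrow> c k j * (A k j - m)) \<le> e * (case z of (k, j) \<Rightarrow> kernel_weight chi u v k j)"
      using mult_left_mono[OF A[of k j], of "\<bar>c k j\<bar>"]
      by (simp add: z abs_mult kernel_weight_def c_def mult_ac)
  qed
  then have "\<bar>s - m\<bar> \<le> e * (\<Sum>\<^sub>\<infinity>(k, j)\<in>UNIV. kernel_weight chi u v k j)" by simp
  moreover have "has_double_sum (\<lambda>k j. c k j * A k j) s"
    unfolding s_def by (rule abs_summable_imp_has_double_sum[OF cA])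
  ultimately show thesis
    by (intro that) (simp_all add: c_def)
qed

lemma kantorovich_eqI:
  assumes "has_double_sum (kantorovich_term chi w f p) s"
  shows "kantorovich chi w f p = s"
  using assms unfolding has_double_sum_def kantorovich_def by (auto intro: infsumI)

lemma kantorovich_term_eq:
  "kantorovich_term chi w f (x, y) = (\<lambda>k j. log_shift chi k j (x powr w) (y powr w) * cell_mean w f k j)"
  by (simp add: kantorovich_term_def cell_mean_def)

lemma kantorovich_close:
  assumes chi: "chi \<in> kernel_class" and xy: "(x, y) \<in> quadrant"
    and weight: "(\<lambda>(k, j). kernel_weight chi (x powr w) (y powr w) k j) summable_on UNIV"
      "(\<Sum>\<^sub>\<infinity>(k, j)\<in>UNIV. kernel_weight chi (x powr w) (y powr w) k j) \<le> M"
    and "e \<ge> 0"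
    and mean: "\<And>k j. \<bar>cell_mean w f k j - m\<bar> \<le> e * (1 + ((of_int k - w * ln x)\<^sup>2 + (of_int j - w * ln y)\<^sup>2))"
  shows "\<exists>s. has_double_sum (kantorovich_term chi w f (x, y)) s"
    and "\<bar>kantorovich chi w f (x, y) - m\<bar> \<le> e * M"
proof -
  have uv: "(x powr w, y powr w) \<in> quadrant" and ln: "ln (x powr w) = w * ln x" "ln (y powr w) = w * ln y"
    using xy by (auto simp: quadrant_def ln_powr)
  from chi uv have one: "has_double_sum (\<lambda>k j. log_shift chi k j (x powr w) (y powr w)) 1"
    by (auto simp: kernel_class_def)
  obtain s where s: "has_double_sum (kantorovich_term chi w f (x, y)) s"
    "\<bar>s - m\<bar> \<le> e * (\<Sum>\<^sub>\<infinity>(k, j)\<in>UNIV. kernel_weight chi (x powr w) (y powr w) k j)"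
    unfolding kantorovich_term_eq
    by (rule kernel_sum_close[OF weight(1) one, of "cell_mean w f" m e, unfolded ln, OF mean])
  then show "\<exists>s. has_double_sum (kantorovich_term chi w f (x, y)) s" by blast
  show "\<bar>kantorovich chi w f (x, y) - m\<bar> \<le> e * M"
    using s(2) mult_left_mono[OF weight(2) \<open>e \<ge> 0\<close>] by (simp add: kantorovich_eqI[OF s(1)])
qed

lemma kantorovich_defined_of_bounded:
  assumes chi: "chi \<in> kernel_class" and f: "f \<in> L_infty" "locally_integrable f" and w: "w > 0"
  shows "kantorovich_defined chi w f"
  unfolding kantorovich_defined_def
proof
  fix p assume p: "p \<in> quadrant"
  obtain x y where xy: "p = (x, y)" by (cases p)
  obtain C where C: "\<And>z. z \<in> quadrant \<Longrightarrow> \<bar>f z\<bar> \<le> C"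
    using f(1) by (auto simp: L_infty_def bounded_iff)
  then have "C \<ge> 0" using C[OF p] by linarith
  obtain M where M: "\<And>u v. (u, v) \<in> quadrant \<Longrightarrow> (\<lambda>(k, j). kernel_weight chi u v k j) summable_on UNIV"
    "\<And>u v. (u, v) \<in> quadrant \<Longrightarrow> (\<Sum>\<^sub>\<infinity>(k, j)\<in>UNIV. kernel_weight chi u v k j) \<le> M"
    using kernel_weight_bounded[OF chi] by metis
  have uv: "(x powr w, y powr w) \<in> quadrant"
    using p by (auto simp: xy quadrant_def)
  show "\<exists>s. has_double_sum (kantorovich_term chi w f p) s"
    unfolding xy
  proof (rule kantorovich_close(1)[OF chi p[unfolded xy] M(1)[OF uv] M(2)[OF uv] \<open>C \<ge> 0\<close>])
    fix k j
    have "\<bar>cell_mean w f k j - 0\<bar> \<le> C"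
      by (rule cell_mean_close[OF f(2) w]) (use C in \<open>auto simp: quadrant_def\<close>)
    also have "C * 1 \<le> C * (1 + ((of_int k - w * ln x)\<^sup>2 + (of_int j - w * ln y)\<^sup>2))"
      using \<open>C \<ge> 0\<close> by (intro mult_left_mono) auto
    finally show "\<bar>cell_mean w f k j - 0\<bar> \<le> C * (1 + ((of_int k - w * ln x)\<^sup>2 + (of_int j - w * ln y)\<^sup>2))"
      by simp
  qed
qed

text \<open>
  A square in logarithmic coordinates is convenient because the condition on the two indices
  of a cell can then be checked separately.
\<close>

definition log_box_oscillation :: "(real \<times> real \<Rightarrow> real) \<Rightarrow> real \<Rightarrow> real \<Rightarrow> real \<times> real \<Rightarrow> bool"
  where "log_box_oscillation f d e p \<longleftrightarrow>
    (\<forall>u v. \<bar>u - ln (fst p)\<bar> \<le> d \<and> \<bar>v - ln (snd p)\<bar> \<le> d \<longrightarrow> \<bar>f (exp u, exp v) - f p\<bar> \<le> e)"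

text \<open>
  Let \<open>q\<close> be the squared distance of \<open>(k, j)\<close> from \<open>(w * ln x, w * ln y)\<close>. If both coordinates of
  the difference are at most \<open>w * d / 2\<close>, the whole cell lies in the square on which \<open>f\<close> oscillates
  by at most \<open>e\<close>, provided that its side \<open>1 / w\<close> is at most \<open>d / 2\<close>. Otherwise
  \<open>q \<ge> (w * d / 2)\<^sup>2\<close>, and the trivial bound \<open>2 * C\<close> for the error is at most \<open>e * q\<close> as soon as \<open>w\<close>
  is large. So the error is at most \<open>e * (1 + q)\<close> in both cases. How large \<open>w\<close> must be
  depends on \<open>e\<close>, \<open>d\<close> and \<open>C\<close> but not on the point, so the same lemma serves for pointwise and for
  uniform convergence.
\<close>

lemma kantorovich_close_of_oscillation:
  assumes chi: "chi \<in> kernel_class" and f: "f \<in> L_infty" "locally_integrable f"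
  obtains M where "M > 0" and "\<And>e d. e > 0 \<Longrightarrow> d > 0 \<Longrightarrow>
    eventually (\<lambda>w. \<forall>p\<in>quadrant. log_box_oscillation f d e p \<longrightarrow> \<bar>kantorovich chi w f p - f p\<bar> \<le> e * M) at_top"
proof -
  obtain C where C: "\<And>z. z \<in> quadrant \<Longrightarrow> \<bar>f z\<bar> \<le> C"
    using f(1) by (auto simp: L_infty_def bounded_iff)
  obtain M where "M \<ge> 0" and M: "\<And>u v. (u, v) \<in> quadrant \<Longrightarrow> (\<lambda>(k, j). kernel_weight chi u v k j) summable_on UNIV"
    "\<And>u v. (u, v) \<in> quadrant \<Longrightarrow> (\<Sum>\<^sub>\<infinity>(k, j)\<in>UNIV. kernel_weight chi u v k j) \<le> M"
    using kernel_weight_bounded[OF chi] by metis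
  (* M + 1 instead of M, so that the constant is positive and can be divided by *)
  show thesis
  proof (rule that[of "M + 1"])
    fix e d :: real assume e: "e > 0" and d: "d > 0"
    (* w >= 2 / d makes the cells small; the last entry, together with w <= w^2,
       makes e * (w * d / 2)^2 exceed 2 * C *)
    define W where "W = max 1 (max (2 / d) (8 * C / (e * d\<^sup>2)))"
    show "eventually (\<lambda>w. \<forall>p\<in>quadrant. log_box_oscillation f d e p \<longrightarrow>
        \<bar>kantorovich chi w f p - f p\<bar> \<le> e * (M + 1)) at_top"
    proof (rule eventually_at_top_linorderI[of W], safe)
      fix w x y assume "W \<le> w" and xy: "(x, y) \<in> quadrant" and osc: "log_box_oscillation f d e (x, y)"
      then have w: "w \<ge> 1" "w \<ge> 2 / d" "w \<ge> 8 * C / (e * d\<^sup>2)" by (auto simp: W_def)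
      then have "w > 0" by linarith
      have "1 / w \<le> d / 2" using w(2) d \<open>w > 0\<close> by (simp add: field_simps)
      have "8 * C \<le> w * (e * d\<^sup>2)"
        using w(3) e d by (simp add: field_simps)
      also have "\<dots> \<le> w\<^sup>2 * (e * d\<^sup>2)"
        using w(1) e by (intro mult_right_mono) (auto simp: power2_eq_square)
      finally have large: "2 * C \<le> e * (w * (d / 2))\<^sup>2"
        by (simp add: power_mult_distrib power_divide mult_ac)
      have uv: "(x powr w, y powr w) \<in> quadrant"
        using xy by (auto simp: quadrant_def)
      have "\<bar>kantorovich chi w f (x, y) - f (x, y)\<bar> \<le> e * M"
      proof (rule kantorovich_close(2)[OF chi xy M(1)[OF uv] M(2)[OF uv] less_imp_le[OF e]])
        fix k j :: int
        define q where "q = (of_int k - w * ln x)\<^sup>2 + (of_int j - w * ln y)\<^sup>2"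
        have "q \<ge> 0" by (simp add: q_def)
        have "\<bar>cell_mean w f k j - f (x, y)\<bar> \<le> e * (1 + q)"
        proof (cases "\<bar>of_int k - w * ln x\<bar> \<le> w * (d / 2) \<and> \<bar>of_int j - w * ln y\<bar> \<le> w * (d / 2)")
          case True
          have near: "\<bar>t - l\<bar> \<le> d" if "\<bar>of_int n - w * l\<bar> \<le> w * (d / 2)"
            "t \<in> {of_int n / w..(of_int n + 1) / w}" for n :: int and t l
          proof -
            have "\<bar>of_int n / w - l\<bar> = \<bar>of_int n - w * l\<bar> / w"
              using abs_div_pos[OF \<open>w > 0\<close>, of "of_int n - w * l"] \<open>w > 0\<close>
              by (simp add: diff_divide_distrib)
            also have "\<dots> \<le> d / 2" using that(1) \<open>w > 0\<close> by (simp add: field_simps)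
            finally have "\<bar>of_int n / w - l\<bar> \<le> d / 2" .
            moreover have "\<bar>t - of_int n / w\<bar> \<le> d / 2"
              using that(2) \<open>1 / w \<le> d / 2\<close> by (auto simp: add_divide_distrib)
            ultimately show ?thesis by linarith
          qed
          have "\<bar>cell_mean w f k j - f (x, y)\<bar> \<le> e"
            by (rule cell_mean_close[OF f(2) \<open>w > 0\<close>])
              (use osc True near in \<open>auto simp: log_box_oscillation_def\<close>)
          also have "e * 1 \<le> e * (1 + q)" using e \<open>q \<ge> 0\<close> by (intro mult_left_mono) auto
          finally show ?thesis by simp
        next
          case False
          have "0 \<le> w * (d / 2)" using \<open>w > 0\<close> d by simp
          with False have "(w * (d / 2))\<^sup>2 \<le> \<bar>of_int k - w * ln x\<bar>\<^sup>2 \<or> (w * (d / 2))\<^sup>2 \<le> \<bar>of_int j - w * ln y\<bar>\<^sup>2"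
            by (meson power_mono linear)
          then have "(w * (d / 2))\<^sup>2 \<le> q"
            using zero_le_power2[of "of_int k - w * ln x"] zero_le_power2[of "of_int j - w * ln y"]
            unfolding q_def power2_abs by linarith
          then have "e * (w * (d / 2))\<^sup>2 \<le> e * q" using e by (intro mult_left_mono) auto
          have "\<bar>cell_mean w f k j - f (x, y)\<bar> \<le> 2 * C"
          proof (rule cell_mean_close[OF f(2) \<open>w > 0\<close>])
            fix u v
            have "(exp u, exp v) \<in> quadrant" by (simp add: quadrant_def)
            from C[OF this] C[OF xy] show "\<bar>f (exp u, exp v) - f (x, y)\<bar> \<le> 2 * C" by linarith
          qed
          also note large
          also note \<open>e * (w * (d / 2))\<^sup>2 \<le> e * q\<close>
          also have "e * q \<le> e * (1 + q)" using e by simp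
          finally show ?thesis .
        qed
        then show "\<bar>cell_mean w f k j - f (x, y)\<bar> \<le> e * (1 + ((of_int k - w * ln x)\<^sup>2 + (of_int j - w * ln y)\<^sup>2))"
          by (simp add: q_def)
      qed
      also have "e * M \<le> e * (M + 1)" using e by simp
      finally show "\<bar>kantorovich chi w f (x, y) - f (x, y)\<bar> \<le> e * (M + 1)" .
    qed
  qed (use \<open>M \<ge> 0\<close> in simp)
qed

lemma continuous_imp_log_box_oscillation:
  assumes p: "p \<in> quadrant" and cont: "continuous (at p within quadrant) f" and e: "e > 0"
  obtains d where "d > 0" "log_box_oscillation f d e p"
proof -
  define E where "E = (\<lambda>z :: real \<times> real. (exp (fst z), exp (snd z)))"
  define l where "l = (ln (fst p), ln (snd p))"
  have El: "E l = p" using p by (cases p) (simp add: E_def l_def quadrant_def)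
  have "continuous (at l) E"
    unfolding E_def by (intro continuous_intros)
  moreover have "continuous (at (E l) within range E) f"
    unfolding El by (rule continuous_within_subset[OF cont]) (auto simp: E_def quadrant_def)
  ultimately have "continuous (at l) (f \<circ> E)"
    by (rule continuous_within_compose)
  with e obtain r where r: "r > 0" "\<And>z. dist z l < r \<Longrightarrow> \<bar>f (E z) - f p\<bar> < e"
    unfolding continuous_at_eps_delta dist_real_def comp_def El by metis
  have "\<bar>f (exp u, exp v) - f p\<bar> \<le> e" if "\<bar>u - ln (fst p)\<bar> \<le> r / 3" "\<bar>v - ln (snd p)\<bar> \<le> r / 3" for u v
  proof -
    have "dist (u, v) l \<le> \<bar>u - ln (fst p)\<bar> + \<bar>v - ln (snd p)\<bar>"
      unfolding l_def dist_Pair_Pair dist_real_def by (rule sqrt_sum_squares_le_sum_abs[THEN order_trans]) simp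
    also have "\<dots> < r" using that r(1) by linarith
    finally show ?thesis using r(2)[of "(u, v)"] by (simp add: E_def)
  qed
  then show thesis
    using r(1) by (intro that[of "r / 3"]) (auto simp: log_box_oscillation_def)
qed

lemma log_unif_continuous_imp_log_box_oscillation:
  assumes f: "log_unif_continuous f" and e: "e > 0"
  obtains d where "d > 0" "\<And>p. p \<in> quadrant \<Longrightarrow> log_box_oscillation f d e p"
proof -
  obtain r where r: "r > 0" "\<And>x y u v. (x, y) \<in> quadrant \<Longrightarrow> (u, v) \<in> quadrant \<Longrightarrow>
     (ln x - ln u)\<^sup>2 + (ln y - ln v)\<^sup>2 < r\<^sup>2 \<Longrightarrow> \<bar>f (x, y) - f (u, v)\<bar> < e"
    using f e unfolding log_unif_continuous_def by meson
  have "\<bar>f (exp u, exp v) - f (x, y)\<bar> \<le> e"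
    if "(x, y) \<in> quadrant" "\<bar>u - ln x\<bar> \<le> r / 2" "\<bar>v - ln y\<bar> \<le> r / 2" for x y u v
  proof -
    have "(u - ln x)\<^sup>2 \<le> (r / 2)\<^sup>2" "(v - ln y)\<^sup>2 \<le> (r / 2)\<^sup>2"
      using that(2,3) r(1) by (metis abs_le_square_iff abs_of_pos half_gt_zero)+
    moreover have "(r / 2)\<^sup>2 + (r / 2)\<^sup>2 < r\<^sup>2"
      using r(1) by (simp add: power2_eq_square field_simps)
    ultimately have "(ln (exp u) - ln x)\<^sup>2 + (ln (exp v) - ln y)\<^sup>2 < r\<^sup>2" by simp
    then show ?thesis
      using r(2)[of "exp u" "exp v" x y] that(1) by (simp add: quadrant_def)
  qed
  then show thesis
    using r(1) by (intro that[of "r / 2"]) (auto simp: log_box_oscillation_def)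
qed

section \<open>Pointwise and uniform convergence\<close>

theorem theorem3p1:
  fixes chi f :: "real \<times> real \<Rightarrow> real"
  assumes "chi \<in> kernel_class"
  shows "(f \<in> L_infty \<and> locally_integrable f \<longrightarrow>
            (\<forall>w>0. kantorovich_defined chi w f) \<and>
            (\<forall>p\<in>quadrant. continuous (at p within quadrant) f \<longrightarrow>
               ((\<lambda>w. kantorovich chi w f p) \<longlongrightarrow> f p) at_top)) \<and>
         (f \<in> log_unif_cont_bdd \<longrightarrow>
            (\<forall>w>0. kantorovich_defined chi w f) \<and>
            ((\<lambda>w. sup_norm (\<lambda>p. kantorovich chi w f p - f p)) \<longlongrightarrow> 0) at_top)"
proof (intro conjI impI)
  assume f: "f \<in> L_infty \<and> locally_integrable f"
  then show "\<forall>w>0. kantorovich_defined chi w f"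
    using kantorovich_defined_of_bounded[OF assms] by blast
  obtain M where M: "M > 0" "\<And>e d. e > 0 \<Longrightarrow> d > 0 \<Longrightarrow>
    eventually (\<lambda>w. \<forall>p\<in>quadrant. log_box_oscillation f d e p \<longrightarrow> \<bar>kantorovich chi w f p - f p\<bar> \<le> e * M) at_top"
    using kantorovich_close_of_oscillation[OF assms conjunct1[OF f] conjunct2[OF f]] by blast
  show "\<forall>p\<in>quadrant. continuous (at p within quadrant) f \<longrightarrow>
      ((\<lambda>w. kantorovich chi w f p) \<longlongrightarrow> f p) at_top"
  proof (intro ballI impI tendstoI)
    fix p and eps :: real
    assume p: "p \<in> quadrant" "continuous (at p within quadrant) f" and "eps > 0"
    define e where "e = eps / (2 * M)"
    have "e > 0" "e * M < eps" using M(1) \<open>eps > 0\<close> by (simp_all add: e_def)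
    obtain d where "d > 0" "log_box_oscillation f d e p"
      using continuous_imp_log_box_oscillation[OF p \<open>e > 0\<close>] by blast
    with M(2)[OF \<open>e > 0\<close> \<open>d > 0\<close>] \<open>e * M < eps\<close> p(1)
    show "\<forall>\<^sub>F w in at_top. dist (kantorovich chi w f p) (f p) < eps"
      by (auto simp: dist_real_def elim!: eventually_mono)
  qed
next
  assume f: "f \<in> log_unif_cont_bdd"
  then have luc: "log_unif_continuous f" and fL: "f \<in> L_infty"
    by (auto simp: log_unif_cont_bdd_def L_infty_def)
  have fI: "locally_integrable f"
    by (intro continuous_on_imp_locally_integrable log_unif_continuous_imp_continuous_on luc)
  show "\<forall>w>0. kantorovich_defined chi w f"
    using kantorovich_defined_of_bounded[OF assms fL fI] by blast
  obtain M where M: "M > 0" "\<And>e d. e > 0 \<Longrightarrow> d > 0 \<Longrightarrow>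
    eventually (\<lambda>w. \<forall>p\<in>quadrant. log_box_oscillation f d e p \<longrightarrow> \<bar>kantorovich chi w f p - f p\<bar> \<le> e * M) at_top"
    using kantorovich_close_of_oscillation[OF assms fL fI] by blast
  show "((\<lambda>w. sup_norm (\<lambda>p. kantorovich chi w f p - f p)) \<longlongrightarrow> 0) at_top"
  proof (rule order_tendstoI)
    fix y :: ennreal assume "0 < y"
    then obtain z where z: "0 < z" "z < y" using dense by blast
    then have "z \<noteq> top" by auto
    then obtain eps where "z = ennreal eps" by (cases z) auto
    with z have eps: "0 < eps" "ennreal eps < y" by auto
    define e where "e = eps / M"
    have "e > 0" "e * M = eps" using M(1) eps(1) by (simp_all add: e_def)
    obtain d where "d > 0" and d: "\<And>p. p \<in> quadrant \<Longrightarrow> log_box_oscillation f d e p"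
      using log_unif_continuous_imp_log_box_oscillation[OF luc \<open>e > 0\<close>] by blast
    from M(2)[OF \<open>e > 0\<close> \<open>d > 0\<close>]
    show "\<forall>\<^sub>F w in at_top. sup_norm (\<lambda>p. kantorovich chi w f p - f p) < y"
    proof eventually_elim
      case (elim w)
      with d have "sup_norm (\<lambda>p. kantorovich chi w f p - f p) \<le> ennreal eps"
        unfolding sup_norm_def \<open>e * M = eps\<close> by (intro SUP_least ennreal_leI) auto
      with eps(2) show ?case by (rule le_less_trans[rotated])
    qed
  qed simp
qed

end
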